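(* Let $p=(12,R)$ be the mesh pattern with $R=\{(0,0),(0,1),(1,0),(1,1),(2,2)\}$. Let $F(x)=\sum_{n\ge0}n!\,x^n$, $F(x,q)=\sum_{n\ge 0}x^n\sum_{\pi\in S_n}q^{p(\pi)}$, and $A(x)=\sum_{n\ge0}|S_n(p)|x^n$. Then, as formal power series in $x$, $$A(x)=\frac{2F(x)-1}{F(x)},\qquad F(x,q)= \frac{(2-q)F(x)+q-1}{(1-q)F(x)+q}.$$
   Context: $S_n$ is the set of permutations $\pi=\pi_1\cdots\pi_n$ of $\{1,\dots,n\}$ ($S_0$ contains only the empty permutation). A mesh pattern $(12,R)$ consists of the permutation $12$ and a set $R\subseteq\{0,1,2\}\times\{0,1,2\}$ of shaded boxes. An occurrence of $(12,R)$ in $\pi\in S_n$ is a pair of positions $s<t$ with $\pi_s<\pi_t$ such that, putting $s_0=0,\ s_1=s,\ s_2=t,\ s_3=n+1$ and $v_0=0,\ v_1=\pi_s,\ v_2=\pi_t,\ v_3=n+1$, for every $(i,j)\in R$ there is no position $m$ with $s_i<m<s_{i+1}$ and $v_j<\pi_m<v_{j+1}$. $p(\pi)$ is the number of occurrences of $p$ in $\pi$, and $S_n(p)$ is the set of $\pi\in S_n$ with $p(\pi)=0$ (permutations avoiding $p$). *)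

theory Defs
  imports
    "HOL-Combinatorics.Permutations"
    "HOL-Computational_Algebra.Formal_Power_Series"
    "HOL-Computational_Algebra.Fraction_Field"
    "HOL-Computational_Algebra.Polynomial"
begin

text \<open>The permutation \<open>\<pi>\<^sub>1\<cdots>\<pi>\<^sub>n\<close> is the function with \<open>\<pi> i = \<pi>\<^sub>i\<close> for \<open>1 \<le> i \<le> n\<close>, extended by the identity
  outside \<open>{1..n}\<close>.\<close>

definition perms :: "nat \<Rightarrow> (nat \<Rightarrow> nat) set" where
  "perms n = {\<pi>. \<pi> permutes {1..n}}"

text \<open>Occurrences of the mesh pattern \<open>(12, R)\<close>. The lists are the grid lines
  \<open>s\<^sub>0, s\<^sub>1, s\<^sub>2, s\<^sub>3\<close> (positions) and \<open>v\<^sub>0, v\<^sub>1, v\<^sub>2, v\<^sub>3\<close> (values); the set \<open>R\<close> is meant to be a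
  subset of \<open>{0,1,2} \<times> {0,1,2}\<close>.\<close>

definition mesh12_occs :: "(nat \<times> nat) set \<Rightarrow> nat \<Rightarrow> (nat \<Rightarrow> nat) \<Rightarrow> (nat \<times> nat) set" where
  "mesh12_occs R n \<pi> = {(s, t). s \<in> {1..n} \<and> t \<in> {1..n} \<and> s < t \<and> \<pi> s < \<pi> t \<and>
     (\<forall>(i, j) \<in> R. \<not> (\<exists>m \<in> {1..n}.
        [0, s, t, n + 1] ! i < m \<and> m < [0, s, t, n + 1] ! (i + 1) \<and>
        [0, \<pi> s, \<pi> t, n + 1] ! j < \<pi> m \<and> \<pi> m < [0, \<pi> s, \<pi> t, n + 1] ! (j + 1)))}"

definition mesh12_count :: "(nat \<times> nat) set \<Rightarrow> nat \<Rightarrow> (nat \<Rightarrow> nat) \<Rightarrow> nat" where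
  "mesh12_count R n \<pi> = card (mesh12_occs R n \<pi>)"

definition R_shaded :: "(nat \<times> nat) set" where
  "R_shaded = {(0,0), (0,1), (1,0), (1,1), (2,2)}"

definition mesh12_avoiders :: "(nat \<times> nat) set \<Rightarrow> nat \<Rightarrow> (nat \<Rightarrow> nat) set" where
  "mesh12_avoiders R n = {\<pi> \<in> perms n. mesh12_count R n \<pi> = 0}"

definition fact_gf :: "'a::comm_ring_1 fps" where
  "fact_gf = Abs_fps (\<lambda>n. of_nat (fact n))"

definition mesh12_avoid_gf :: "(nat \<times> nat) set \<Rightarrow> 'a::comm_ring_1 fps" where
  "mesh12_avoid_gf R = Abs_fps (\<lambda>n. of_nat (card (mesh12_avoiders R n)))"

definition mesh12_distr_gf :: "(nat \<times> nat) set \<Rightarrow> 'a::comm_ring_1 \<Rightarrow> 'a fps" where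
  "mesh12_distr_gf R q = Abs_fps (\<lambda>n. \<Sum>\<pi>\<in>perms n. q ^ mesh12_count R n \<pi>)"

text \<open>The indeterminate \<open>q\<close>, as an element of the field \<open>\<rat>(q)\<close>. Power series in \<open>x\<close> are taken over this
  field so that quotients of power series are the library's division (all denominators used have
  constant term 1).\<close>

definition q_indet :: "rat poly fract" where
  "q_indet = Fract [:0, 1:] 1"

end

theory Submission
  imports Defs "HOL-Combinatorics.Multiset_Permutations"
begin

text \<open>
  Why the theorem holds. In an occurrence \<open>(s, t)\<close> of the pattern, the four shaded boxes at the
  bottom left say that \<open>\<pi> s\<close> is the only entry before position \<open>t\<close> that is smaller than \<open>\<pi> t\<close>, and the
  box \<open>(2,2)\<close> says that everything after position \<open>t\<close> is smaller than \<open>\<pi> t\<close> (\<open>mem_mesh12_occs\<close>). So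
  \<open>t\<close> determines \<open>s\<close>, and counting occurrences means counting the values \<open>v = \<pi> t\<close> that are
  right-to-left maxima with exactly one smaller entry to their left. They are called apexes below.

  Suppose that \<open>v\<close> is an apex of \<open>\<pi> = L v R\<close>, and let \<open>a\<close> be the smaller entry in \<open>L\<close>. The entries below
  \<open>v\<close> are then exactly \<open>a\<close> and those of \<open>R\<close>, so \<open>a R\<close> is an arbitrary arrangement of \<open>1, \<dots>, v - 1\<close>;
  writing \<open>v\<close> in place of \<open>a\<close> turns \<open>L\<close> into an arbitrary arrangement of \<open>v, \<dots>, n\<close>, and the two
  arrangements determine \<open>\<pi>\<close> (\<open>bij_betw_glue\<close>). Moreover the apexes of \<open>\<pi>\<close> that are smaller than \<open>v\<close>
  are the apexes of \<open>a R\<close> (\<open>apexes_below_apex\<close>). Hence, if \<open>T\<^sub>m\<close> is the sum of \<open>q\<^bsup>apexes\<^esup>\<close> over the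
  permutations of size \<open>m\<close>, the pairs of a permutation of size \<open>n\<close> and an apex \<open>v\<close> of it, weighted by
  \<open>q\<close> to the number of apexes below \<open>v\<close>, contribute \<open>(n + 1 - v)! T\<^bsub>v-1\<^esub>\<close> for each value \<open>v \<ge> 2\<close>.

  By the geometric sum, \<open>q\<^sup>k - 1\<close> is \<open>q - 1\<close> times the sum of these weights over the \<open>k\<close> apexes of one
  permutation. Therefore \<open>T\<^sub>n = n! + (q - 1) \<Sum>\<^sub>v (n + 1 - v)! T\<^bsub>v-1\<^esub>\<close> (\<open>apex_poly_rec\<close>), which for
  generating functions reads \<open>T - 1 = (F - 1) + (q - 1) (F - 1) (T - 1)\<close>. Solving this linear equation
  for \<open>T\<close> gives the formula for \<open>F(x,q)\<close>, and \<open>q = 0\<close> gives the one for \<open>A(x)\<close>.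
\<close>

unbundle fps_syntax

section \<open>Apexes of a word\<close>

text \<open>The single smaller entry before \<open>v\<close> is demanded in the form \<open>filter _ L = [a]\<close> because this names
  \<open>a\<close> and because filtering by a lower threshold can then be done on \<open>[a]\<close> instead of \<open>L\<close>.\<close>

definition apexes :: "nat list \<Rightarrow> nat set" where
  "apexes xs = {v. \<exists>L R a. xs = L @ v # R \<and> (\<forall>x\<in>set R. x < v) \<and> filter (\<lambda>x. x < v) L = [a]}"

lemma apexes_subset: "apexes xs \<subseteq> set xs"
  by (auto simp: apexes_def)

lemma finite_apexes: "finite (apexes xs)"
  using apexes_subset finite_subset by blast

text \<open>For a threshold \<open>w < v\<close>, the prefixes \<open>L @ v # R0\<close> and \<open>a # R0\<close> have the same entries below \<open>w\<close>,
  since \<open>a\<close> is the only entry of \<open>L\<close> that can qualify. An apex below \<open>v\<close> must stand to the right of \<open>v\<close>,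
  as it exceeds everything after it.\<close>

lemma apexes_below_apex:
  assumes R: "\<forall>x\<in>set R. x < v" and a: "filter (\<lambda>x. x < v) L = [a]"
  shows "{w \<in> apexes (L @ v # R). w < v} = apexes (a # R)"
proof -
  have filter_eq: "filter (\<lambda>x. x < w) (L @ v # R0) = filter (\<lambda>x. x < w) (a # R0)"
    if "w < v" for w R0
  proof -
    have "filter (\<lambda>x. x < w) L = filter (\<lambda>x. x < w) (filter (\<lambda>x. x < v) L)"
      using that by (auto simp: intro!: filter_cong)
    with a that show ?thesis by simp
  qed
  show ?thesis
  proof (intro subset_antisym subsetI)
    fix w assume "w \<in> {w \<in> apexes (L @ v # R). w < v}"
    then obtain L1 R1 b where w: "w < v" "L @ v # R = L1 @ w # R1" "\<forall>x\<in>set R1. x < w"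
      "filter (\<lambda>x. x < w) L1 = [b]"
      by (auto simp: apexes_def)
    then have "v \<notin> set R1" by auto
    with w(1,2) obtain R0 where R0: "L1 = L @ v # R0" "R = R0 @ w # R1"
      by (auto simp: append_eq_append_conv2 Cons_eq_append_conv append_eq_Cons_conv)
    with w filter_eq[OF w(1), of R0] show "w \<in> apexes (a # R)"
      unfolding apexes_def by (intro CollectI exI[of _ "a # R0"] exI[of _ R1] exI[of _ b]) auto
  next
    fix w assume "w \<in> apexes (a # R)"
    then obtain L1 R1 b where w: "a # R = L1 @ w # R1" "\<forall>x\<in>set R1. x < w"
      "filter (\<lambda>x. x < w) L1 = [b]"
      by (auto simp: apexes_def)
    from w(1,3) obtain R0 where R0: "L1 = a # R0" "R = R0 @ w # R1"
      by (cases L1) auto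
    with R have "w < v" by auto
    with w R0 filter_eq[OF this, of R0]
    show "w \<in> {w \<in> apexes (L @ v # R). w < v}"
      unfolding apexes_def
      by (intro CollectI conjI exI[of _ "L @ v # R0"] exI[of _ R1] exI[of _ b]) auto
  qed
qed

text \<open>The geometric sum \<open>1 + q + \<dots> + q\<^bsup>k-1\<^esup>\<close>, with its exponents read as ranks of the elements
  of \<open>V\<close>. Ranks are what a decomposition at one chosen element can see.\<close>

lemma power_card_eq_geometric:
  fixes q :: "'a::comm_ring_1"
  assumes "finite (V :: 'b::linorder set)"
  shows "q ^ card V = 1 + (q - 1) * (\<Sum>v\<in>V. q ^ card {w \<in> V. w < v})"
  using assms
proof (induction V rule: finite_linorder_max_induct)
  case (insert b A)
  then have "b \<notin> A" by auto
  have "{w \<in> insert b A. w < b} = A" using insert by auto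
  moreover have "{w \<in> insert b A. w < v} = {w \<in> A. w < v}" if "v \<in> A" for v
    using insert that by (auto dest: less_trans)
  ultimately have "(\<Sum>v\<in>insert b A. q ^ card {w \<in> insert b A. w < v})
      = q ^ card A + (\<Sum>v\<in>A. q ^ card {w \<in> A. w < v})"
    using insert \<open>b \<notin> A\<close> by (auto intro!: sum.cong)
  moreover have "q ^ card (insert b A) = q ^ card A + (q - 1) * q ^ card A"
    using insert.hyps \<open>b \<notin> A\<close> by (simp add: algebra_simps)
  moreover note arg_cong[OF insert.IH, of "\<lambda>x. x + (q - 1) * q ^ card A"]
  ultimately show ?case
    by (simp only: distrib_left add.assoc add.commute add.left_commute)
qed simp

section \<open>Cutting a permutation at an apex\<close>

text \<open>The inverse of the cut at an apex \<open>v\<close>. The entry \<open>v\<close> of \<open>us\<close> is a placeholder for the first entry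
  of \<open>r\<close>, which becomes the only entry before the apex that is smaller than it.\<close>

definition glue :: "nat \<Rightarrow> nat list \<times> nat list \<Rightarrow> nat list" where
  "glue v = (\<lambda>(us, r). map (id(v := hd r)) us @ v # tl r)"

lemma filter_eq_singleton:
  assumes "distinct xs" "{x \<in> set xs. P x} = {a}"
  shows "filter P xs = [a]"
proof -
  have "set (filter P xs) = {a}" "distinct (filter P xs)"
    using assms by auto
  then have "length (filter P xs) = 1"
    using distinct_card by fastforce
  with \<open>set (filter P xs) = {a}\<close> show ?thesis
    by (auto simp: length_Suc_conv simp del: set_filter)
qed

text \<open>The bound \<open>2 \<le> v\<close> makes \<open>r\<close> nonempty, so that its head \<open>a\<close> exists. The word \<open>U1 @ a # U2\<close> is the
  part before the apex \<open>v\<close>; its entries other than \<open>a\<close> come from \<open>us\<close> and exceed \<open>v\<close>.\<close>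

lemma glue_split:
  assumes "us \<in> permutations_of_set {v..n}" "r \<in> permutations_of_set {1..v-1}"
    and v: "2 \<le> v" "v \<le> n"
  obtains U1 U2 a R where "us = U1 @ v # U2" "r = a # R" "glue v (us, r) = (U1 @ a # U2) @ v # R"
    "filter (\<lambda>x. x < v) (U1 @ a # U2) = [a]" "\<forall>x\<in>set R. x < v"
    "glue v (us, r) \<in> permutations_of_set {1..n}"
proof -
  have us: "distinct us" "set us = {v..n}" and r: "distinct r" "set r = {1..v-1}"
    using assms by (auto dest: permutations_of_setD)
  obtain U1 U2 where U: "us = U1 @ v # U2"
    using us v by (metis atLeastAtMost_iff order_refl split_list)
  obtain a R where aR: "r = a # R"
    using r v by (cases r) auto
  have "v \<notin> set U1" "v \<notin> set U2" using us U by auto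
  then have glue: "glue v (us, r) = (U1 @ a # U2) @ v # R"
    using U aR by (auto simp: glue_def intro!: map_idI)
  have Uv: "set U1 \<union> set U2 = {v<..n}"
  proof -
    have "set U1 \<union> set U2 = set us - {v}"
      using U \<open>v \<notin> set U1\<close> \<open>v \<notin> set U2\<close> by auto
    also have "\<dots> = {v<..n}" unfolding us by auto
    finally show ?thesis .
  qed
  have ins: "insert a (set R) = {1..v-1}" and "a \<notin> set R" using r aR by auto
  then have R: "set R = {1..v-1} - {a}" unfolding ins[symmetric] by simp
  have "a \<in> {1..v-1}" unfolding ins[symmetric] by simp
  then have a: "1 \<le> a" "a < v" by auto
  have "a \<notin> set U1 \<union> set U2" "v \<notin> set R" "(set U1 \<union> set U2) \<inter> set R = {}"
    unfolding Uv R using a by auto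
  then have dist: "distinct ((U1 @ a # U2) @ v # R)"
    using us(1) r(1) a(2) unfolding U aR by auto
  have "set (U1 @ a # U2) = insert a {v<..n}" unfolding Uv[symmetric] by auto
  then have "{x \<in> set (U1 @ a # U2). x < v} = {a}"
    using a(2) by (simp only:) auto
  moreover have "distinct (U1 @ a # U2)" using dist by auto
  ultimately have filter: "filter (\<lambda>x. x < v) (U1 @ a # U2) = [a]"
    by (metis filter_eq_singleton)
  have "set ((U1 @ a # U2) @ v # R) = {1..n}"
  proof -
    have "set ((U1 @ a # U2) @ v # R) = (set U1 \<union> set U2) \<union> {a, v} \<union> set R" by auto
    also have "\<dots> = {1..n}" using v a unfolding Uv R by auto
    finally show ?thesis .
  qed
  then have "glue v (us, r) \<in> permutations_of_set {1..n}"
    unfolding glue using dist by (rule permutations_of_setI)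
  moreover have "\<forall>x\<in>set R. x < v" unfolding R by auto
  ultimately show ?thesis
    using that[OF U aR glue filter] by blast
qed

lemma glue_correct:
  assumes "us \<in> permutations_of_set {v..n}" "r \<in> permutations_of_set {1..v-1}"
    and "2 \<le> v" "v \<le> n"
  shows "glue v (us, r) \<in> permutations_of_set {1..n}" "v \<in> apexes (glue v (us, r))"
    "{w \<in> apexes (glue v (us, r)). w < v} = apexes r"
proof -
  from assms obtain U1 U2 a R where *: "us = U1 @ v # U2" "r = a # R"
    "glue v (us, r) = (U1 @ a # U2) @ v # R"
    "filter (\<lambda>x. x < v) (U1 @ a # U2) = [a]" "\<forall>x\<in>set R. x < v"
    "glue v (us, r) \<in> permutations_of_set {1..n}"
    by (rule glue_split)
  show "glue v (us, r) \<in> permutations_of_set {1..n}" by fact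
  show "v \<in> apexes (glue v (us, r))"
    unfolding apexes_def using *(3-5) by blast
  from apexes_below_apex[OF *(5,4)]
  show "{w \<in> apexes (glue v (us, r)). w < v} = apexes r"
    using * by simp
qed

text \<open>The cut can be read off the glued word: \<open>v\<close> occurs once, and \<open>a\<close> is the only entry before it that
  is smaller than \<open>v\<close>.\<close>

lemma inj_on_glue:
  assumes v: "2 \<le> v" "v \<le> n"
  shows "inj_on (glue v) (permutations_of_set {v..n} \<times> permutations_of_set {1..v-1})"
proof (rule inj_onI, clarify)
  fix us r us' r'
  assume us: "us \<in> permutations_of_set {v..n}" and r: "r \<in> permutations_of_set {1..v-1}"
    and us': "us' \<in> permutations_of_set {v..n}" and r': "r' \<in> permutations_of_set {1..v-1}"
    and eq: "glue v (us, r) = glue v (us', r')"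
  from us r v obtain U1 U2 a R where *: "us = U1 @ v # U2" "r = a # R"
    "glue v (us, r) = (U1 @ a # U2) @ v # R"
    "filter (\<lambda>x. x < v) (U1 @ a # U2) = [a]" "\<forall>x\<in>set R. x < v"
    "glue v (us, r) \<in> permutations_of_set {1..n}"
    by (rule glue_split)
  from us' r' v obtain U1' U2' a' R' where **: "us' = U1' @ v # U2'" "r' = a' # R'"
    "glue v (us', r') = (U1' @ a' # U2') @ v # R'"
    "filter (\<lambda>x. x < v) (U1' @ a' # U2') = [a']" "\<forall>x\<in>set R'. x < v"
    "glue v (us', r') \<in> permutations_of_set {1..n}"
    by (rule glue_split)
  have dist: "distinct ((U1 @ a # U2) @ v # R)"
    using *(3,6) by (metis permutations_of_setD(2))
  have eq': "(U1 @ a # U2) @ v # R = (U1' @ a' # U2') @ v # R'"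
    using eq *(3) **(3) by simp
  have "v \<notin> set (U1 @ a # U2)" "v \<notin> set R" "a \<notin> set U1" "a \<notin> set U2"
    using dist by auto
  note split = append_Cons_eq_iff[OF this(1,2)] append_Cons_eq_iff[OF this(3,4)]
  have "U1 @ a # U2 = U1' @ a' # U2' \<and> R = R'"
    using eq' unfolding split(1) .
  moreover from this have "a = a'" using *(4) **(4) by simp
  moreover from calculation have "U1 = U1' \<and> U2 = U2'"
    using split(2) by blast
  ultimately show "us = us' \<and> r = r'" using * ** by simp
qed

text \<open>Every permutation with apex \<open>v\<close> can be cut: among the values below \<open>v\<close>, only \<open>a\<close> lies before \<open>v\<close>,
  and none of those above \<open>v\<close> lies after it. So the two pieces contain exactly the values \<open>1, \<dots>, v - 1\<close>
  and, once \<open>a\<close> is overwritten by \<open>v\<close>, the values \<open>v, \<dots>, n\<close>.\<close>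

lemma bij_betw_glue:
  assumes v: "2 \<le> v" "v \<le> n"
  shows "bij_betw (glue v) (permutations_of_set {v..n} \<times> permutations_of_set {1..v-1})
     {xs \<in> permutations_of_set {1..n}. v \<in> apexes xs}"
  unfolding bij_betw_def
proof (intro conjI inj_on_glue v subset_antisym image_subsetI subsetI)
  fix p assume "p \<in> permutations_of_set {v..n} \<times> permutations_of_set {1..v-1}"
  then show "glue v p \<in> {xs \<in> permutations_of_set {1..n}. v \<in> apexes xs}"
    using glue_correct v by (cases p) auto
next
  fix xs assume "xs \<in> {xs \<in> permutations_of_set {1..n}. v \<in> apexes xs}"
  then have dist: "distinct xs" and set: "set xs = {1..n}" and "v \<in> apexes xs"
    by (auto dest: permutations_of_setD)
  then obtain L R a where xs: "xs = L @ v # R" and R: "\<forall>x\<in>set R. x < v"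
    and a: "filter (\<lambda>x. x < v) L = [a]"
    by (auto simp: apexes_def)
  have L: "{x \<in> set L. x < v} = {a}"
    using arg_cong[OF a, of set] by simp
  then have "a \<in> set L" "a < v" by auto
  have aR: "a # R \<in> permutations_of_set {1..v-1}"
  proof (rule permutations_of_setI)
    show "distinct (a # R)" using dist xs \<open>a \<in> set L\<close> by auto
    have "x \<in> insert a (set R)" if "1 \<le> x" "x < v" for x
    proof -
      have "x \<in> set xs" using that v set by auto
      then show ?thesis using xs L that by auto
    qed
    moreover have "1 \<le> x" if "x \<in> set xs" for x using that set by auto
    ultimately show "set (a # R) = {1..v-1}"
      using R \<open>a < v\<close> \<open>a \<in> set L\<close> xs by fastforce
  qed
  define us where "us = map (id(a := v)) L"
  have "v \<notin> set L" using dist xs by auto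
  have us: "us \<in> permutations_of_set {v..n}"
  proof (rule permutations_of_setI)
    have "inj_on (id(a := v)) (set L)"
      using \<open>v \<notin> set L\<close> by (auto simp: inj_on_def)
    then show "distinct us" using dist xs by (auto simp: us_def distinct_map)
    have "set us = insert v (set L - {a})"
      using \<open>a \<in> set L\<close> by (auto simp: us_def)
    also have "set L - {a} = {v<..n}"
    proof (intro subset_antisym subsetI)
      fix x assume "x \<in> set L - {a}"
      moreover from this have "\<not> x < v" "x \<noteq> v" "x \<in> set xs"
        using L \<open>v \<notin> set L\<close> xs by auto
      ultimately show "x \<in> {v<..n}" using set by auto
    next
      fix x assume x: "x \<in> {v<..n}"
      then have "x \<in> set xs" using set by auto
      then show "x \<in> set L - {a}" using x xs R \<open>a < v\<close> by auto
    qed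
    also have "insert v {v<..n} = {v..n}" using v by auto
    finally show "set us = {v..n}" .
  qed
  have "map (id(v := a)) us = L"
    using \<open>v \<notin> set L\<close> by (auto simp: us_def intro!: map_idI)
  then have "xs = glue v (us, a # R)" by (simp add: glue_def xs)
  then show "xs \<in> glue v ` (permutations_of_set {v..n} \<times> permutations_of_set {1..v-1})"
    using us aR by blast
qed

section \<open>The recurrence for the distribution of apexes\<close>

definition apex_poly :: "'a::comm_ring_1 \<Rightarrow> nat \<Rightarrow> 'a" where
  "apex_poly q n = (\<Sum>xs\<in>permutations_of_set {1..n}. q ^ card (apexes xs))"

lemma apexes_ge_2:
  assumes "xs \<in> permutations_of_set {1..n}" "v \<in> apexes xs"
  shows "v \<in> {2..n}"
proof -
  have set: "set xs = {1..n}" using assms by (auto dest: permutations_of_setD)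
  from assms obtain L R a where *: "xs = L @ v # R" "filter (\<lambda>x. x < v) L = [a]"
    by (auto simp: apexes_def)
  have "a \<in> set (filter (\<lambda>x. x < v) L)" unfolding *(2) by simp
  then have "a < v" "a \<in> set L" by auto
  moreover have "set L \<subseteq> set xs" "v \<in> set xs" unfolding *(1) by auto
  ultimately show ?thesis unfolding set by auto
qed

text \<open>Apply the geometric sum to the apex set of each permutation and exchange the two summations. For a
  fixed \<open>v\<close>, cutting at \<open>v\<close> leaves a sum over pairs whose weight depends on the second component only;
  the first one contributes the number \<open>(n + 1 - v)!\<close> of arrangements of \<open>v, \<dots>, n\<close>.\<close>

lemma apex_poly_rec:
  "apex_poly q n = of_nat (fact n) +
     (q - 1) * (\<Sum>v=2..n. of_nat (fact (n + 1 - v)) * apex_poly q (v - 1))"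
proof -
  let ?P = "permutations_of_set {1..n}"
  let ?f = "\<lambda>xs v. q ^ card {w \<in> apexes xs. w < v}"
  have fibre: "(\<Sum>xs | xs \<in> ?P \<and> v \<in> apexes xs. ?f xs v)
      = of_nat (fact (n + 1 - v)) * apex_poly q (v - 1)" if "v \<in> {2..n}" for v
  proof -
    have v: "2 \<le> v" "v \<le> n" using that by auto
    have "(\<Sum>xs | xs \<in> ?P \<and> v \<in> apexes xs. ?f xs v)
      = (\<Sum>p\<in>permutations_of_set {v..n} \<times> permutations_of_set {1..v-1}. ?f (glue v p) v)"
      by (rule sum.reindex_bij_betw[OF bij_betw_glue[OF v], symmetric])
    also have "\<dots> = (\<Sum>(us, r)\<in>permutations_of_set {v..n} \<times> permutations_of_set {1..v-1}.
        q ^ card (apexes r))"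
      using glue_correct(3) v by (intro sum.cong) (auto split: prod.splits)
    also have "\<dots> = of_nat (fact (n + 1 - v)) * apex_poly q (v - 1)"
      by (simp add: sum.cartesian_product[symmetric] apex_poly_def)
    finally show ?thesis .
  qed
  have "apex_poly q n = (\<Sum>xs\<in>?P. 1 + (q - 1) * (\<Sum>v\<in>apexes xs. ?f xs v))"
    unfolding apex_poly_def by (intro sum.cong refl power_card_eq_geometric finite_apexes)
  also have "\<dots> = of_nat (fact n) + (q - 1) * (\<Sum>xs\<in>?P. \<Sum>v\<in>apexes xs. ?f xs v)"
    by (simp add: sum.distrib sum_distrib_left)
  also have "(\<Sum>xs\<in>?P. \<Sum>v\<in>apexes xs. ?f xs v)
      = (\<Sum>xs\<in>?P. \<Sum>v\<in>{v\<in>{2..n}. v \<in> apexes xs}. ?f xs v)"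
    by (intro sum.cong refl) (use apexes_ge_2 in blast)
  also have "\<dots> = (\<Sum>v=2..n. \<Sum>xs | xs \<in> ?P \<and> v \<in> apexes xs. ?f xs v)"
    by (rule sum.swap_restrict) auto
  also have "\<dots> = (\<Sum>v=2..n. of_nat (fact (n + 1 - v)) * apex_poly q (v - 1))"
    using fibre by (rule sum.cong[OF refl])
  finally show ?thesis .
qed

section \<open>Occurrences of the pattern are apexes\<close>

definition word :: "nat \<Rightarrow> (nat \<Rightarrow> nat) \<Rightarrow> nat list" where
  "word n \<pi> = map \<pi> [1..<n+1]"

lemma set_upt_1: "set [1..<n+1] = {1..n}"
  by auto

lemma bij_betw_word: "bij_betw (word n) (perms n) (permutations_of_set {1..n})"
proof -
  have inj: "inj_on (word n) (perms n)"
  proof (rule inj_onI)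
    fix \<pi> \<rho> assume *: "\<pi> \<in> perms n" "\<rho> \<in> perms n" "word n \<pi> = word n \<rho>"
    show "\<pi> = \<rho>"
    proof
      fix i
      have "\<forall>i\<in>{1..n}. \<pi> i = \<rho> i"
        using *(3) unfolding word_def map_eq_conv set_upt_1 .
      then show "\<pi> i = \<rho> i"
        using *(1,2) by (cases "i \<in> {1..n}") (auto simp: perms_def permutes_not_in)
    qed
  qed
  moreover have "word n ` perms n = permutations_of_set {1..n}"
  proof (rule card_subset_eq)
    show "word n ` perms n \<subseteq> permutations_of_set {1..n}"
    proof (intro image_subsetI permutations_of_setI)
      fix \<pi> assume "\<pi> \<in> perms n"
      then have "\<pi> permutes {1..n}" by (simp add: perms_def)
      then show "set (word n \<pi>) = {1..n}" "distinct (word n \<pi>)"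
        using permutes_image[of \<pi> "{1..n}"] permutes_inj_on[of \<pi> "{1..n}"]
        by (simp_all only: word_def distinct_map set_upt_1 set_map distinct_upt)
    qed
    show "card (word n ` perms n) = card (permutations_of_set {1..n})"
      using inj by (simp add: card_image perms_def card_permutations)
  qed simp
  ultimately show ?thesis by (simp add: bij_betw_def)
qed

text \<open>The open boxes \<open>(0,0)\<close>, \<open>(0,1)\<close>, \<open>(1,0)\<close>, \<open>(1,1)\<close> cover the region to the left of and below the
  point \<open>(t, \<pi> t)\<close> except for the grid lines through \<open>(s, \<pi> s)\<close>. By injectivity of \<open>\<pi>\<close>, these lines
  meet the graph of \<open>\<pi>\<close> only at that point.\<close>

lemma mem_mesh12_occs:
  assumes "\<pi> \<in> perms n"
  shows "(s, t) \<in> mesh12_occs R_shaded n \<pi> \<longleftrightarrow> t \<in> {1..n} \<and>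
    {m. 1 \<le> m \<and> m < t \<and> \<pi> m < \<pi> t} = {s} \<and> (\<forall>m. t < m \<and> m \<le> n \<longrightarrow> \<pi> m < \<pi> t)"
proof -
  have p: "\<pi> permutes {1..n}" using assms by (simp add: perms_def)
  have inj: "\<pi> i = \<pi> j \<longleftrightarrow> i = j" for i j
    using permutes_inj[OF p] by (auto simp: inj_def)
  have range: "1 \<le> \<pi> m \<and> \<pi> m \<le> n" if "1 \<le> m" "m \<le> n" for m
    using permutes_in_image[OF p, of m] that by auto
  show ?thesis (is "?L \<longleftrightarrow> ?R")
  proof
    assume ?L
    then have st: "1 \<le> s" "s < t" "t \<le> n" "\<pi> s < \<pi> t"
      and box: "\<And>i j m. (i, j) \<in> R_shaded \<Longrightarrow> m \<in> {1..n} \<Longrightarrow>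
        [0, s, t, n + 1] ! i < m \<Longrightarrow> m < [0, s, t, n + 1] ! (i + 1) \<Longrightarrow>
        [0, \<pi> s, \<pi> t, n + 1] ! j < \<pi> m \<Longrightarrow> \<pi> m < [0, \<pi> s, \<pi> t, n + 1] ! (j + 1) \<Longrightarrow> False"
      unfolding mesh12_occs_def by auto
    have uniq: "m = s" if "1 \<le> m" "m < t" "\<pi> m < \<pi> t" for m
    proof (rule ccontr)
      assume "m \<noteq> s"
      then have "m < s \<or> s < m" "\<pi> m < \<pi> s \<or> \<pi> s < \<pi> m" using inj[of m s] by linarith+
      then show False
        using that st range[of m] box[of 0 0 m] box[of 0 1 m] box[of 1 0 m] box[of 1 1 m]
        by (auto simp: R_shaded_def)
    qed
    have max: "\<pi> m < \<pi> t" if "t < m" "m \<le> n" for m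
    proof (rule ccontr)
      assume "\<not> \<pi> m < \<pi> t"
      then have "\<pi> t < \<pi> m" using inj[of m t] that by linarith
      then show False using that st range[of m] box[of 2 2 m] by (auto simp: R_shaded_def)
    qed
    have "{m. 1 \<le> m \<and> m < t \<and> \<pi> m < \<pi> t} = {s}"
      using uniq st by blast
    with max st show ?R by simp
  next
    assume R: ?R
    then have st: "1 \<le> s" "s < t" "t \<le> n" "\<pi> s < \<pi> t" by auto
    have uniq: "m = s" if "1 \<le> m" "m < t" "\<pi> m < \<pi> t" for m using that R by auto
    have "False" if "(i, j) \<in> R_shaded" "m \<in> {1..n}"
        "[0, s, t, n + 1] ! i < m" "m < [0, s, t, n + 1] ! (i + 1)"
        "[0, \<pi> s, \<pi> t, n + 1] ! j < \<pi> m" "\<pi> m < [0, \<pi> s, \<pi> t, n + 1] ! (j + 1)" for i j m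
    proof -
      have "m = s" if "m < t" "\<pi> m < \<pi> t"
        using that \<open>m \<in> {1..n}\<close> uniq by simp
      moreover have "\<pi> m < \<pi> t" if "t < m"
        using that \<open>m \<in> {1..n}\<close> R by simp
      ultimately show False
        using that(1,3-6) \<open>s < t\<close> \<open>\<pi> s < \<pi> t\<close> unfolding R_shaded_def
        by (elim insertE emptyE; simp)
    qed
    with st show ?L
      unfolding mesh12_occs_def by auto
  qed
qed

lemma mesh12_count_eq_card_apexes:
  assumes "\<pi> \<in> perms n"
  shows "mesh12_count R_shaded n \<pi> = card (apexes (word n \<pi>))"
proof -
  have p: "\<pi> permutes {1..n}" using assms by (simp add: perms_def)
  have inj: "\<pi> i = \<pi> j \<longleftrightarrow> i = j" for i j
    using permutes_inj[OF p] by (auto simp: inj_def)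
  have "bij_betw (\<lambda>(s, t). \<pi> t) (mesh12_occs R_shaded n \<pi>) (apexes (word n \<pi>))"
    unfolding bij_betw_def
  proof (intro conjI subset_antisym subsetI)
    show "inj_on (\<lambda>(s, t). \<pi> t) (mesh12_occs R_shaded n \<pi>)"
      by (auto simp: inj_on_def inj mem_mesh12_occs[OF assms])
  next
    fix v assume "v \<in> (\<lambda>(s, t). \<pi> t) ` mesh12_occs R_shaded n \<pi>"
    then obtain s t where v: "v = \<pi> t" and st: "(s, t) \<in> mesh12_occs R_shaded n \<pi>" by auto
    note st = st[unfolded mem_mesh12_occs[OF assms]]
    have "[1..<n+1] = [1..<t] @ t # [t+1..<n+1]"
      using st upt_add_eq_append[of 1 t "n + 1 - t"] upt_conv_Cons[of t "n + 1"] by simp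
    then have "word n \<pi> = map \<pi> [1..<t] @ v # map \<pi> [t+1..<n+1]"
      by (simp add: word_def v)
    moreover have "filter (\<lambda>m. \<pi> m < \<pi> t) [1..<t] = [s]"
      using st by (intro filter_eq_singleton) auto
    then have "filter (\<lambda>x. x < v) (map \<pi> [1..<t]) = [\<pi> s]"
      by (simp add: v filter_map o_def)
    moreover have "\<forall>x\<in>set (map \<pi> [t+1..<n+1]). x < v"
      using st v by auto
    ultimately show "v \<in> apexes (word n \<pi>)"
      unfolding apexes_def by blast
  next
    fix v assume "v \<in> apexes (word n \<pi>)"
    then obtain L R a where *: "word n \<pi> = L @ v # R" "\<forall>x\<in>set R. x < v"
      "filter (\<lambda>x. x < v) L = [a]"
      by (auto simp: apexes_def)
    then obtain I t K where t: "[1..<n+1] = I @ t # K" "L = map \<pi> I" "v = \<pi> t" "R = map \<pi> K"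
      unfolding word_def by (auto simp: map_eq_append_conv map_eq_Cons_conv)
    \<comment> \<open>The list of positions is \<open>1, \<dots>, n\<close>, so its prefix \<open>I\<close> and its suffix \<open>K\<close> are intervals
      determined by \<open>t\<close>.\<close>
    have len: "length I < n"
      using arg_cong[OF t(1), of length] by (simp del: upt_Suc)
    have "[1..<n+1] ! length I = t" by (simp only: t(1) nth_append_length)
    with len have tI: "t = length I + 1" by (simp del: upt_Suc)
    with len have tn: "1 \<le> t" "t \<le> n" by auto
    have "take (length I) [1..<n+1] = I" by (simp only: t(1)) simp
    then have I: "I = [1..<t]" using len tI by (simp add: take_upt)
    have "drop (Suc (length I)) [1..<n+1] = K" by (simp only: t(1)) simp
    then have K: "K = [t+1..<n+1]" using tI by (simp del: upt_Suc)
    have "map \<pi> (filter (\<lambda>m. \<pi> m < \<pi> t) [1..<t]) = [a]"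
      using * t I by (simp add: filter_map o_def)
    then obtain s where "filter (\<lambda>m. \<pi> m < \<pi> t) [1..<t] = [s]" by auto
    from arg_cong[OF this, of set] have "{m. 1 \<le> m \<and> m < t \<and> \<pi> m < \<pi> t} = {s}"
      by (auto simp: set_eq_iff)
    moreover have "\<pi> m < \<pi> t" if "t < m" "m \<le> n" for m
    proof -
      have "m \<in> set K" using that K by auto
      then show ?thesis using *(2) t(3,4) by simp
    qed
    ultimately have "(s, t) \<in> mesh12_occs R_shaded n \<pi>"
      using tn unfolding mem_mesh12_occs[OF assms] by simp
    with t show "v \<in> (\<lambda>(s, t). \<pi> t) ` mesh12_occs R_shaded n \<pi>" by force
  qed
  then show ?thesis by (simp add: mesh12_count_def bij_betw_same_card)
qed

section \<open>The generating functions\<close>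

lemma mesh12_distr_gf_nth: "mesh12_distr_gf R_shaded q $ n = apex_poly q n"
proof -
  have "apex_poly q n = (\<Sum>\<pi>\<in>perms n. q ^ card (apexes (word n \<pi>)))"
    unfolding apex_poly_def by (rule sum.reindex_bij_betw[OF bij_betw_word, symmetric])
  then show ?thesis
    by (simp add: mesh12_distr_gf_def mesh12_count_eq_card_apexes)
qed

text \<open>Removing the constant terms turns the recurrence into a convolution, because the index \<open>v - 1\<close>
  in it runs through \<open>1, \<dots>, n - 1\<close>. Stating the result without division keeps it valid over every
  commutative ring, so that \<open>q\<close> can be an indeterminate as well as \<open>0\<close>.\<close>

lemma mesh12_distr_gf_functional_equation:
  "mesh12_distr_gf R_shaded q * (fps_const (1 - q) * fact_gf + fps_const q)
     = fps_const (2 - q) * fact_gf + fps_const q - (1 :: 'a::comm_ring_1 fps)"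
proof -
  define T F where "T = mesh12_distr_gf R_shaded q - 1" and "F = (fact_gf - 1 :: 'a fps)"
  have T: "T $ n = F $ n + (q - 1) * (\<Sum>i=0..n. F $ i * T $ (n - i))" for n
  proof (cases "n = 0")
    case False
    have "(\<Sum>i=0..n. F $ i * T $ (n - i))
        = (\<Sum>i=1..n-1. of_nat (fact i) * apex_poly q (n - i))"
      by (rule sum.mono_neutral_cong_right)
        (auto simp: F_def T_def fact_gf_def mesh12_distr_gf_nth apex_poly_def apexes_def not_less_eq_eq)
    also have "\<dots> = (\<Sum>v=2..n. of_nat (fact (n + 1 - v)) * apex_poly q (v - 1))"
      using False by (intro sum.reindex_bij_witness[of _ "\<lambda>v. n + 1 - v" "\<lambda>i. n + 1 - i"]) auto
    finally show ?thesis
      using False apex_poly_rec[of q n] by (simp add: T_def F_def mesh12_distr_gf_nth fact_gf_def)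
  qed (simp add: T_def F_def mesh12_distr_gf_nth apex_poly_def apexes_def fact_gf_def)
  have T_eq: "T = F + fps_const (q - 1) * (F * T)"
    by (rule fps_ext, subst T) (simp only: fps_add_nth fps_mult_left_const_nth fps_mult_nth[of F])
  have c: "fps_const (1 - q) = 1 - fps_const q" "fps_const (2 - q) = 2 - fps_const q"
    "fps_const (q - 1) = fps_const q - 1"
    by (simp_all flip: fps_const_sub add: numeral_fps_const)
  have T1: "mesh12_distr_gf R_shaded q = 1 + T" and F1: "fact_gf = 1 + F"
    by (simp_all add: T_def F_def)
  have "mesh12_distr_gf R_shaded q * (fps_const (1 - q) * fact_gf + fps_const q)
      = 1 + F - fps_const q * F + (T - fps_const (q - 1) * (F * T))"
    unfolding c T1 F1 by (simp add: algebra_simps)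
  also have "T - fps_const (q - 1) * (F * T) = F"
    using T_eq by (metis add_diff_cancel_right')
  also have "1 + F - fps_const q * F + F = fps_const (2 - q) * fact_gf + fps_const q - 1"
    unfolding c F1 by (simp add: algebra_simps)
  finally show ?thesis .
qed

text \<open>Here \<open>0\<^sup>0 = 1\<close> matters: at \<open>q = 0\<close> exactly the avoiders keep weight \<open>1\<close>.\<close>

lemma mesh12_avoid_gf_eq_distr_at_0:
  "mesh12_avoid_gf R = (mesh12_distr_gf R 0 :: 'a::comm_ring_1 fps)"
proof (rule fps_ext)
  fix n
  have "(\<Sum>\<pi>\<in>perms n. (0 :: 'a) ^ mesh12_count R n \<pi>)
      = (\<Sum>\<pi>\<in>mesh12_avoiders R n. 1)"
    by (rule sum.mono_neutral_cong_right)
      (auto simp: mesh12_avoiders_def perms_def finite_permutations power_0_left split: if_splits)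
  then show "mesh12_avoid_gf R $ n = (mesh12_distr_gf R 0 $ n :: 'a)"
    by (simp add: mesh12_avoid_gf_def mesh12_distr_gf_def)
qed

theorem theorem3p13:
  shows "(mesh12_avoid_gf R_shaded :: rat fps) = (2 * fact_gf - 1) / fact_gf \<and>
    mesh12_distr_gf R_shaded q_indet =
      (fps_const (2 - q_indet) * fact_gf + fps_const q_indet - 1) /
      (fps_const (1 - q_indet) * fact_gf + fps_const q_indet)"
proof
  have quotient: "T = N / D" if "T * D = N" "D $ 0 = 1" for T N D :: "'b::field fps"
    using that by (metis fps_zero_nth nonzero_mult_div_cancel_right zero_neq_one)
  show "(mesh12_avoid_gf R_shaded :: rat fps) = (2 * fact_gf - 1) / fact_gf"
    using mesh12_distr_gf_functional_equation[of "0 :: rat"]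
    by (intro quotient) (simp_all add: mesh12_avoid_gf_eq_distr_at_0 fact_gf_def numeral_fps_const)
  show "mesh12_distr_gf R_shaded q_indet =
      (fps_const (2 - q_indet) * fact_gf + fps_const q_indet - 1) /
      (fps_const (1 - q_indet) * fact_gf + fps_const q_indet)"
    by (rule quotient[OF mesh12_distr_gf_functional_equation]) (simp add: fact_gf_def)
qed

end
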